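(* Let $\alpha\vDash n$, $\beta\vDash m$ be compositions with $\beta\subseteq\alpha$. For any $T\in\mathrm{SIT}(\alpha/\beta)$ with $T\ne S^0_{\alpha/\beta}$, there is a sequence of generators $\pi_{j_i}$ and distinct tableaux $T_i\in\mathrm{SIT}(\alpha/\beta)$, $i=1,\dots,r$, such that $\pi_{j_i}(T_i)=T_{i-1}$ for $i=1,2,\dots,r$, where $T_0=T$ and $T_r=S^0_{\alpha/\beta}$. Hence $S^0_{\alpha/\beta}\preccurlyeq T$ in the poset $P\mathcal{R}\mathfrak{S}^*_{\alpha/\beta}$ and $T=\pi_{j_1}\pi_{j_2}\cdots\pi_{j_r}(S^0_{\alpha/\beta})$. In particular, $S^0_{\alpha/\beta}$ is the unique minimal element of the poset $P\mathcal{R}\mathfrak{S}^*_{\alpha/\beta}$.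
   Context: Compositions and tableaux. A composition $\alpha=(\alpha_1,\dots,\alpha_k)\vDash n$ is a finite sequence of positive integers with sum $n=|\alpha|$; $\ell(\alpha)=k$; $\emptyset$ is the empty composition of $0$. The diagram of $\alpha$ is the left-justified array of cells with $\alpha_i$ cells in row $i$, rows numbered from bottom to top. $\beta\subseteq\alpha$ means $\ell(\beta)\le\ell(\alpha)$ and $\beta_j\le\alpha_j$ for all $1\le j\le \ell(\beta)$; the skew diagram $\alpha/\beta$ is the set of cells of the diagram of $\alpha$ not in that of $\beta$, where $\beta$ is placed in the bottom-left corner of $\alpha$. $\mathrm{SIT}(\alpha/\beta)$ is the set of bijective fillings of the cells of $\alpha/\beta$ with $1,\dots,|\alpha|-|\beta|$ such that the entries in the cells of the leftmost column of $\alpha$ that are not in $\beta$ increase from bottom to top, and all rows increase from left to right. $S^0_{\alpha/\beta}\in\mathrm{SIT}(\alpha/\beta)$ is the tableau in which the cells of the first column of $\alpha$ remaining in $\alpha/\beta$ (if any) are filled with $1,\dots,\ell(\alpha)-\ell(\beta)$, increasing bottom to top, and then the remaining cells are filled by rows, top to bottom, left to right within rows, with the consecutive integers $\ell(\alpha)-\ell(\beta)+1,\dots,n-m$. Action ($\mathcal{R}\mathfrak{S}^*$-action). For $1\le i\le n-m-1$ and $T\in\mathrm{SIT}(\alpha/\beta)$: $\pi_i(T)=T$ if $i+1$ is in a row strictly above $i$; $\pi_i(T)=s_i(T)$ (switch $i$ and $i+1$) if $i+1$ is in a row strictly below $i$; $\pi_i(T)=0$ if $i,i+1$ are in the same row.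 The skew immaculate Hecke poset $P\mathcal{R}\mathfrak{S}^*_{\alpha/\beta}$ is the set $\mathrm{SIT}(\alpha/\beta)$ with the partial order $\preccurlyeq$ whose cover relations are $S\prec T$ iff $S\neq T$ and $T=\pi_i(S)$ for some $1\le i\le n-m-1$; equivalently $S\preccurlyeq T$ iff $T=\pi_{i_1}\cdots\pi_{i_r}(S)$ for some (possibly empty) sequence of generators. *)

theory Defs
  imports "HOL-Combinatorics.Transposition"
begin

definition is_composition :: "nat \<Rightarrow> nat list \<Rightarrow> bool" where
  "is_composition n \<alpha> \<longleftrightarrow> (\<forall>a\<in>set \<alpha>. 0 < a) \<and> sum_list \<alpha> = n"

definition comp_le :: "nat list \<Rightarrow> nat list \<Rightarrow> bool" where
  "comp_le \<beta> \<alpha> \<longleftrightarrow> length \<beta> \<le> length \<alpha> \<and> (\<forall>j<length \<beta>. \<beta> ! j \<le> \<alpha> ! j)"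

text \<open>Cells are pairs (row, column), both counted from 0; row 0 is the bottom row and
  column 0 the leftmost column.\<close>

type_synonym cell = "nat \<times> nat"

definition diagram :: "nat list \<Rightarrow> cell set" where
  "diagram \<alpha> = {(r, c). r < length \<alpha> \<and> c < \<alpha> ! r}"

definition skew_diagram :: "nat list \<Rightarrow> nat list \<Rightarrow> cell set" where
  "skew_diagram \<alpha> \<beta> = diagram \<alpha> - diagram \<beta>"

text \<open>A filling is extended by 0 outside its diagram, so that equality of functions is equality
  of fillings; 0 is never an entry.\<close>

type_synonym tableau = "cell \<Rightarrow> nat"

definition SIT :: "nat list \<Rightarrow> nat list \<Rightarrow> tableau set" where
  "SIT \<alpha> \<beta> = {T.
     (\<forall>x. x \<notin> skew_diagram \<alpha> \<beta> \<longrightarrow> T x = 0) \<and>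
     bij_betw T (skew_diagram \<alpha> \<beta>) {1..sum_list \<alpha> - sum_list \<beta>} \<and>
     (\<forall>r s. (r, 0) \<in> skew_diagram \<alpha> \<beta> \<longrightarrow> (s, 0) \<in> skew_diagram \<alpha> \<beta> \<longrightarrow> r < s \<longrightarrow>
        T (r, 0) < T (s, 0)) \<and>
     (\<forall>r c d. (r, c) \<in> skew_diagram \<alpha> \<beta> \<longrightarrow> (r, d) \<in> skew_diagram \<alpha> \<beta> \<longrightarrow> c < d \<longrightarrow>
        T (r, c) < T (r, d))}"

text \<open>The cells of the skew diagram in the order in which \<open>S0\<close> numbers them.\<close>

definition S0_cells :: "nat list \<Rightarrow> nat list \<Rightarrow> cell list" where
  "S0_cells \<alpha> \<beta> =
     [(r, 0). r \<leftarrow> [0..<length \<alpha>], (r, 0) \<in> skew_diagram \<alpha> \<beta>] @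
     [(r, c). r \<leftarrow> rev [0..<length \<alpha>], c \<leftarrow> [1..<\<alpha> ! r], (r, c) \<in> skew_diagram \<alpha> \<beta>]"

definition S0 :: "nat list \<Rightarrow> nat list \<Rightarrow> tableau" where
  "S0 \<alpha> \<beta> x =
     (case map_of (zip (S0_cells \<alpha> \<beta>) [1..<Suc (length (S0_cells \<alpha> \<beta>))]) x of
        None \<Rightarrow> 0 | Some k \<Rightarrow> k)"

definition row_of :: "tableau \<Rightarrow> nat \<Rightarrow> nat" where
  "row_of T i = (THE r. \<exists>c. T (r, c) = i)"

text \<open>The generators act on \<open>SIT \<alpha> \<beta>\<close> together with a zero, which is represented by \<open>None\<close>
  and is fixed by every generator.\<close>

definition hecke_pi :: "nat \<Rightarrow> tableau \<Rightarrow> tableau option" where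
  "hecke_pi i T =
     (if row_of T i < row_of T (i + 1) then Some T
      else if row_of T (i + 1) < row_of T i then Some (Transposition.transpose i (i + 1) \<circ> T)
      else None)"

text \<open>For a word \<open>[i\<^sub>1, \<dots>, i\<^sub>r]\<close> the last letter acts first.\<close>

definition hecke_word :: "nat list \<Rightarrow> tableau \<Rightarrow> tableau option" where
  "hecke_word w T = foldr (\<lambda>i X. Option.bind X (hecke_pi i)) w (Some T)"

definition SIT_cover :: "nat list \<Rightarrow> nat list \<Rightarrow> tableau rel" where
  "SIT_cover \<alpha> \<beta> = {(S, T). S \<in> SIT \<alpha> \<beta> \<and> T \<in> SIT \<alpha> \<beta> \<and> S \<noteq> T \<and>
     (\<exists>i\<in>{1..sum_list \<alpha> - sum_list \<beta> - 1}. hecke_pi i S = Some T)}"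

definition SIT_poset :: "nat list \<Rightarrow> nat list \<Rightarrow> tableau rel" where
  "SIT_poset \<alpha> \<beta> = (SIT_cover \<alpha> \<beta>)\<^sup>* \<inter> SIT \<alpha> \<beta> \<times> SIT \<alpha> \<beta>"

lemma finite_skew_diagram: "finite (skew_diagram \<alpha> \<beta>)"
proof -
  have "diagram \<alpha> = (SIGMA r:{..<length \<alpha>}. {..<\<alpha> ! r})"
    by (auto simp: diagram_def)
  then show ?thesis by (simp add: skew_diagram_def)
qed

lemma SIT_outside: "T \<in> SIT \<alpha> \<beta> \<Longrightarrow> x \<notin> skew_diagram \<alpha> \<beta> \<Longrightarrow> T x = 0"
  unfolding SIT_def by blast

lemma row_of_eq:
  assumes T: "T \<in> SIT \<alpha> \<beta>" and "T (r, c) = i" "0 < i"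
  shows "row_of T i = r"
proof -
  have out: "x \<in> skew_diagram \<alpha> \<beta>" if "T x = i" for x
    using SIT_outside[OF T, of x] that \<open>0 < i\<close> by auto
  have inj: "inj_on T (skew_diagram \<alpha> \<beta>)"
    using T by (auto simp: SIT_def bij_betw_def)
  show ?thesis unfolding row_of_def
  proof (rule the_equality)
    show "\<exists>c. T (r, c) = i" using assms by blast
    fix s assume "\<exists>d. T (s, d) = i"
    then obtain d where "T (s, d) = i" by blast
    then have "(s, d) = (r, c)"
      using inj_onD[OF inj, of "(s, d)" "(r, c)"] out assms(2) by simp
    then show "s = r" by simp
  qed
qed

lemma entry_exists:
  assumes "T \<in> SIT \<alpha> \<beta>" "i \<in> {1..sum_list \<alpha> - sum_list \<beta>}"
  obtains r c where "(r, c) \<in> skew_diagram \<alpha> \<beta>" "T (r, c) = i"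
proof -
  have "i \<in> T ` skew_diagram \<alpha> \<beta>"
    using assms by (auto simp: SIT_def bij_betw_def)
  then show ?thesis using that by auto
qed

lemma hecke_pi_in_SIT:
  assumes T: "T \<in> SIT \<alpha> \<beta>" and i: "i \<in> {1..sum_list \<alpha> - sum_list \<beta> - 1}"
    and U: "hecke_pi i T = Some U"
  shows "U \<in> SIT \<alpha> \<beta>"
proof (cases "U = T")
  case True
  then show ?thesis using T by simp
next
  case False
  let ?N = "sum_list \<alpha> - sum_list \<beta>"
  have lt: "row_of T (i + 1) < row_of T i" and U_eq: "U = Transposition.transpose i (i + 1) \<circ> T"
    using U False by (auto simp: hecke_pi_def split: if_splits)
  have perm: "bij_betw (Transposition.transpose i (i + 1)) {1..?N} {1..?N}"
    using i by (intro bij_betw_byWitness[where f' = "Transposition.transpose i (i + 1)"])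
      (auto simp: transpose_def)
  have mono: "U x < U y" if "T x < T y" "\<not> fst y < fst x" for x y
  proof -
    have "\<not> (T x = i \<and> T y = i + 1)"
      using row_of_eq[OF T, of "fst x" "snd x" i] row_of_eq[OF T, of "fst y" "snd y" "i + 1"]
        i lt that by auto
    then show ?thesis using that(1) by (auto simp: U_eq transpose_def)
  qed
  have "bij_betw U (skew_diagram \<alpha> \<beta>) {1..?N}"
    unfolding U_eq using T perm by (auto simp: SIT_def intro: bij_betw_trans)
  moreover have "U x = 0" if "x \<notin> skew_diagram \<alpha> \<beta>" for x
  proof -
    have "T x = 0" using SIT_outside[OF T that] .
    then show ?thesis using i by (simp add: U_eq transpose_def)
  qed
  ultimately show ?thesis
    using T by (auto simp: SIT_def intro!: mono)
qed

text \<open>The potential below strictly increases along covers, so the reflexive transitive closure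
  of the covers is antisymmetric.\<close>

lemma SIT_cover_potential:
  assumes "(S, T) \<in> SIT_cover \<alpha> \<beta>"
  shows "(\<Sum>x\<in>skew_diagram \<alpha> \<beta>. S x * fst x) < (\<Sum>x\<in>skew_diagram \<alpha> \<beta>. T x * fst x)"
proof -
  let ?D = "skew_diagram \<alpha> \<beta>"
  from assms obtain i where S: "S \<in> SIT \<alpha> \<beta>" and ne: "S \<noteq> T"
    and i: "i \<in> {1..sum_list \<alpha> - sum_list \<beta> - 1}" and p: "hecke_pi i S = Some T"
    by (auto simp: SIT_cover_def)
  have lt: "row_of S (i + 1) < row_of S i" and T: "T = Transposition.transpose i (i + 1) \<circ> S"
    using p ne by (auto simp: hecke_pi_def split: if_splits)
  have "i \<in> {1..sum_list \<alpha> - sum_list \<beta>}" "i + 1 \<in> {1..sum_list \<alpha> - sum_list \<beta>}"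
    using i by auto
  then obtain r c s d where x: "(r, c) \<in> ?D" "S (r, c) = i" and y: "(s, d) \<in> ?D" "S (s, d) = i + 1"
    using entry_exists[OF S] by metis
  have "s < r"
    using lt row_of_eq[OF S x(2)] row_of_eq[OF S y(2)] i by auto
  have inj: "inj_on S ?D"
    using S by (auto simp: SIT_def bij_betw_def)
  let ?E = "?D - {(r, c), (s, d)}"
  have D: "?D = insert (r, c) (insert (s, d) ?E)"
    using x y by auto
  have split: "(\<Sum>x\<in>?D. f x) = f (r, c) + (f (s, d) + (\<Sum>x\<in>?E. f x))" for f :: "cell \<Rightarrow> nat"
  proof -
    have "(\<Sum>x\<in>?D. f x) = (\<Sum>x\<in>insert (r, c) (insert (s, d) ?E). f x)"
      using D by (rule arg_cong)
    also have "\<dots> = f (r, c) + (f (s, d) + (\<Sum>x\<in>?E. f x))"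
      using \<open>s < r\<close> finite_skew_diagram[of \<alpha> \<beta>] by simp
    finally show ?thesis .
  qed
  have "T z = S z" if "z \<in> ?E" for z
  proof -
    have "S z \<noteq> i" using inj_onD[OF inj, of z "(r, c)"] that x by auto
    moreover have "S z \<noteq> i + 1" using inj_onD[OF inj, of z "(s, d)"] that y by auto
    ultimately show ?thesis by (simp add: T)
  qed
  then have "(\<Sum>z\<in>?E. T z * fst z) = (\<Sum>z\<in>?E. S z * fst z)"
    by (intro sum.cong) auto
  then show ?thesis
    unfolding split[of "\<lambda>x. S x * fst x"] split[of "\<lambda>x. T x * fst x"]
    using x y \<open>s < r\<close> by (simp add: T)
qed

lemma partial_order_SIT_poset: "partial_order_on (SIT \<alpha> \<beta>) (SIT_poset \<alpha> \<beta>)"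
proof -
  let ?f = "\<lambda>S. \<Sum>x\<in>skew_diagram \<alpha> \<beta>. S x * fst x :: nat"
  have incr: "S = T \<or> ?f S < ?f T" if "(S, T) \<in> (SIT_cover \<alpha> \<beta>)\<^sup>*" for S T
    using that
    by (induction rule: rtrancl_induct) (auto dest: SIT_cover_potential)
  have "antisym (SIT_poset \<alpha> \<beta>)"
    proof (rule antisymI)
    fix S T assume "(S, T) \<in> SIT_poset \<alpha> \<beta>" "(T, S) \<in> SIT_poset \<alpha> \<beta>"
    then show "S = T" using incr[of S T] incr[of T S] by (auto simp: SIT_poset_def)
  qed
  moreover have "trans (SIT_poset \<alpha> \<beta>)"
    by (rule transI) (auto simp: SIT_poset_def)
  ultimately show ?thesis
    by (auto simp: partial_order_on_def preorder_on_def refl_on_def SIT_poset_def)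
qed

end

theory Submission
  imports Defs
begin

text \<open>
  A tableau \<open>T\<close> has a lower cover as soon as some \<open>i + 1\<close> lies strictly above \<open>i\<close> and the two
  entries are not both in the first column: exchanging them gives a tableau that \<open>\<pi>\<^sub>i\<close> maps to \<open>T\<close>.
  If no such \<open>i\<close> exists, then the first column, which increases upwards, must carry the smallest
  entries, and the rows of the remaining cells are read from top to bottom; this forces \<open>T = S0\<close>.
  As the potential strictly increases along covers, descending from any \<open>T\<close> ends in \<open>S0\<close>.
  So \<open>S0\<close> is the least element of the poset.
\<close>

section \<open>The reading order of the standard tableau\<close>

text \<open>The numbering order of \<open>S0\<close>, given as a relation on all cells rather than
  on one diagram, so that comparisons of entries can replace positions in a list.\<close>

fun reading_less :: "cell \<Rightarrow> cell \<Rightarrow> bool" where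
  "reading_less (r, c) (s, d) \<longleftrightarrow>
     (if c = 0 then d \<noteq> 0 \<or> r < s else d \<noteq> 0 \<and> (s < r \<or> r = s \<and> c < d))"

lemma reading_less_trans: "reading_less x y \<Longrightarrow> reading_less y z \<Longrightarrow> reading_less x z"
  by (cases x; cases y; cases z) (auto split: if_splits)

lemma reading_less_asym: "reading_less x y \<Longrightarrow> \<not> reading_less y x"
  by (cases x; cases y) (auto split: if_splits)

text \<open>The comprehensions in \<open>S0_cells\<close> unfold to \<open>concat (map ...)\<close>.
  Here \<open>Q\<close> orders the indices of the blocks, and the last premise compares cells from
  different blocks.\<close>

lemma sorted_wrt_concat_map:
  assumes "sorted_wrt Q xs"
    and "\<And>x. x \<in> set xs \<Longrightarrow> sorted_wrt P (f x)"
    and "\<And>x y u v. Q x y \<Longrightarrow> u \<in> set (f x) \<Longrightarrow> v \<in> set (f y) \<Longrightarrow> P u v"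
  shows "sorted_wrt P (concat (map f xs))"
  using assms(1,2)
  by (induction xs) (auto simp: sorted_wrt_append intro: assms(3))

lemma sorted_S0_cells: "sorted_wrt reading_less (S0_cells \<alpha> \<beta>)"
proof -
  \<comment> \<open>Outside the first column the rows are read from the top, so the outer index
    decreases.\<close>
  have desc: "sorted_wrt (>) (rev [0..<length \<alpha>])"
    by (simp add: sorted_wrt_rev)
  show ?thesis
    unfolding S0_cells_def sorted_wrt_append
    by (intro conjI ballI sorted_wrt_concat_map[OF desc]
          sorted_wrt_concat_map[where Q = "(<)"])
      (auto split: if_splits)
qed

lemma set_S0_cells: "set (S0_cells \<alpha> \<beta>) = skew_diagram \<alpha> \<beta>"
proof (intro set_eqI iffI)
  fix x assume "x \<in> skew_diagram \<alpha> \<beta>"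
  then show "x \<in> set (S0_cells \<alpha> \<beta>)"
    by (cases x; cases "snd x = 0") (auto simp: S0_cells_def skew_diagram_def diagram_def)
qed (auto simp: S0_cells_def split: if_splits)

lemma distinct_S0_cells: "distinct (S0_cells \<alpha> \<beta>)"
proof -
  have "distinct xs" if "sorted_wrt reading_less xs" for xs
    using that by (induction xs) (auto dest: reading_less_asym)
  then show ?thesis using sorted_S0_cells .
qed

section \<open>Size of the skew diagram, and the standard tableau as a bijection\<close>

lemma card_diagram: "card (diagram \<alpha>) = sum_list \<alpha>"
proof -
  have "diagram \<alpha> = (SIGMA r:{..<length \<alpha>}. {..<\<alpha> ! r})"
    by (auto simp: diagram_def)
  then show ?thesis by (simp add: sum_list_sum_nth atLeast0LessThan)
qed

lemma finite_diagram: "finite (diagram \<alpha>)"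
  \<comment> \<open>The empty composition removes no cell, so a straight diagram is a special skew
    diagram.\<close>
  using finite_skew_diagram[of \<alpha> "[]"] by (simp add: skew_diagram_def diagram_def)

lemma card_skew_diagram:
  assumes "comp_le \<beta> \<alpha>"
  shows "card (skew_diagram \<alpha> \<beta>) = sum_list \<alpha> - sum_list \<beta>"
proof -
  have "diagram \<beta> \<subseteq> diagram \<alpha>"
    using assms by (fastforce simp: comp_le_def diagram_def)
  then show ?thesis
    by (simp add: skew_diagram_def card_Diff_subset finite_diagram card_diagram)
qed

lemma length_S0_cells:
  "comp_le \<beta> \<alpha> \<Longrightarrow> length (S0_cells \<alpha> \<beta>) = sum_list \<alpha> - sum_list \<beta>"
  using distinct_card[OF distinct_S0_cells] card_skew_diagram by (simp add: set_S0_cells)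

lemma S0_nth: "k < length (S0_cells \<alpha> \<beta>) \<Longrightarrow> S0 \<alpha> \<beta> (S0_cells \<alpha> \<beta> ! k) = Suc k"
  unfolding S0_def using distinct_S0_cells by (subst map_of_zip_nth) (auto simp del: upt_Suc)

lemma S0_outside:
  assumes "x \<notin> skew_diagram \<alpha> \<beta>"
  shows "S0 \<alpha> \<beta> x = 0"
proof -
  have "map_of (zip (S0_cells \<alpha> \<beta>) [1..<Suc (length (S0_cells \<alpha> \<beta>))]) x = None"
    using assms by (subst map_of_zip_is_None) (auto simp: set_S0_cells simp del: upt_Suc)
  then show ?thesis by (simp add: S0_def)
qed

text \<open>Entries of \<open>S0\<close> are positions in a list sorted by
  \<open>reading_less\<close>. Sortedness gives one direction; asymmetry gives the other by
  excluding equal and reversed positions.\<close>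

lemma S0_less_iff:
  assumes "x \<in> skew_diagram \<alpha> \<beta>" "y \<in> skew_diagram \<alpha> \<beta>"
  shows "S0 \<alpha> \<beta> x < S0 \<alpha> \<beta> y \<longleftrightarrow> reading_less x y"
proof -
  let ?xs = "S0_cells \<alpha> \<beta>"
  obtain k l where k: "k < length ?xs" "x = ?xs ! k" and l: "l < length ?xs" "y = ?xs ! l"
    using assms by (metis in_set_conv_nth set_S0_cells)
  have nth: "reading_less (?xs ! a) (?xs ! b)" if "a < b" "b < length ?xs" for a b
    using sorted_wrt_nth_less[OF sorted_S0_cells that] .
  show ?thesis
    using nth[of k l] nth[of l k] reading_less_asym[of x y] reading_less_asym[of x x] k l
    by (cases k l rule: linorder_cases) (auto simp: S0_nth)
qed

lemma bij_betw_S0: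
  assumes "comp_le \<beta> \<alpha>"
  shows "bij_betw (S0 \<alpha> \<beta>) (skew_diagram \<alpha> \<beta>) {1..sum_list \<alpha> - sum_list \<beta>}"
proof -
  let ?xs = "S0_cells \<alpha> \<beta>"
  have "map (S0 \<alpha> \<beta>) ?xs = [1..<Suc (length ?xs)]"
    by (rule nth_equalityI) (simp_all add: S0_nth del: upt_Suc)
  then have "distinct (map (S0 \<alpha> \<beta>) ?xs)" "set (map (S0 \<alpha> \<beta>) ?xs) = {1..length ?xs}"
    by (auto simp del: upt_Suc)
  then show ?thesis
    using length_S0_cells[OF assms]
    by (simp add: bij_betw_def distinct_map set_S0_cells)
qed

lemma S0_in_SIT:
  assumes "comp_le \<beta> \<alpha>"
  shows "S0 \<alpha> \<beta> \<in> SIT \<alpha> \<beta>"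
  using bij_betw_S0[OF assms] by (auto simp: SIT_def S0_outside S0_less_iff)

section \<open>Lower covers\<close>

text \<open>Exchanging two consecutive values can reverse only the comparison between the two cells
  that hold them. The conditions on rows and columns ensure that \<open>SIT\<close> never compares
  these two cells.\<close>

lemma swap_in_SIT:
  assumes T: "T \<in> SIT \<alpha> \<beta>" and x: "x \<in> skew_diagram \<alpha> \<beta>" and y: "y \<in> skew_diagram \<alpha> \<beta>"
    and Ty: "T y = Suc (T x)" and rows: "fst x \<noteq> fst y" and cols: "snd x \<noteq> 0 \<or> snd y \<noteq> 0"
  shows "Transposition.transpose (T x) (Suc (T x)) \<circ> T \<in> SIT \<alpha> \<beta>" (is "?U \<in> _")
proof -
  let ?D = "skew_diagram \<alpha> \<beta>" and ?N = "sum_list \<alpha> - sum_list \<beta>"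
  have bij: "bij_betw T ?D {1..?N}"
    using T by (simp add: SIT_def)
  then have inj: "inj_on T ?D" and im: "T ` ?D = {1..?N}"
    by (auto simp: bij_betw_def)
  have i: "1 \<le> T x" "T x < ?N"
    using im x y Ty by (metis atLeastAtMost_iff image_eqI, metis Suc_le_lessD atLeastAtMost_iff image_eqI)
  have "bij_betw (Transposition.transpose (T x) (Suc (T x))) {1..?N} {1..?N}"
    using i by (intro bij_betw_byWitness[where f' = "Transposition.transpose (T x) (Suc (T x))"])
      (auto simp: transpose_def)
  with bij have bijU: "bij_betw ?U ?D {1..?N}"
    by (rule bij_betw_trans)
  \<comment> \<open>The last condition covers both kinds of comparison required by
    \<open>SIT\<close>: within a row and within the first column.\<close>
  have mono: "?U u < ?U v"
    if "u \<in> ?D" "v \<in> ?D" "T u < T v" "fst u = fst v \<or> snd u = 0 \<and> snd v = 0" for u v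
  proof -
    have "\<not> (T u = T x \<and> T v = T y)"
      using that rows cols inj_onD[OF inj, of u x] inj_onD[OF inj, of v y] x y by auto
    then show ?thesis using that(3) Ty by (auto simp: transpose_def)
  qed
  \<comment> \<open>Both exchanged values are positive, so the default value 0 stays fixed.\<close>
  have "?U u = 0" if "u \<notin> ?D" for u
    using SIT_outside[OF T that] i by (simp add: transpose_def)
  with bijU show ?thesis
    using T unfolding SIT_def by (auto simp del: comp_apply intro!: mono)
qed

lemma lower_cover:
  assumes T: "T \<in> SIT \<alpha> \<beta>" and x: "x \<in> skew_diagram \<alpha> \<beta>" and y: "y \<in> skew_diagram \<alpha> \<beta>"
    and Ty: "T y = Suc (T x)" and rows: "fst x < fst y" and cols: "snd x \<noteq> 0 \<or> snd y \<noteq> 0"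
  shows "(Transposition.transpose (T x) (Suc (T x)) \<circ> T, T) \<in> SIT_cover \<alpha> \<beta>"
    (is "(?U, _) \<in> _")
proof -
  have U: "?U \<in> SIT \<alpha> \<beta>"
    using swap_in_SIT[OF T x y Ty _ cols] rows by simp
  have im: "T ` skew_diagram \<alpha> \<beta> = {1..sum_list \<alpha> - sum_list \<beta>}"
    using T by (auto simp: SIT_def bij_betw_def)
  have "T x \<in> {1..sum_list \<alpha> - sum_list \<beta>}" "T y \<in> {1..sum_list \<alpha> - sum_list \<beta>}"
    using x y im by blast+
  then have i: "T x \<in> {1..sum_list \<alpha> - sum_list \<beta> - 1}" and pos: "0 < T x"
    using Ty by auto
  have ends: "?U x = T x + 1" "?U y = T x"
    using Ty by simp_all
  then have ne: "?U \<noteq> T" by (metis n_not_Suc_n Suc_eq_plus1)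
  \<comment> \<open>After the exchange the smaller value sits in the higher row, so the generator
    takes its swapping branch; the transposition is an involution and restores
    \<open>T\<close>.\<close>
  have "row_of ?U (T x) = fst y"
    by (rule row_of_eq[OF U _ pos, of _ "snd y"]) (simp add: Ty)
  moreover have "row_of ?U (T x + 1) = fst x"
    by (rule row_of_eq[OF U, of _ "snd x"]) simp_all
  moreover have "Transposition.transpose (T x) (T x + 1) \<circ> ?U = T"
    by (simp add: fun_eq_iff)
  ultimately have "hecke_pi (T x) ?U = Some T"
    using rows by (simp only: hecke_pi_def if_True if_False order_less_not_sym simp_thms)
  with U T i ne show ?thesis unfolding SIT_cover_def by blast
qed

section \<open>Tableaux without a lower cover\<close>

lemma column0_skew_diagram:
  assumes "\<forall>b\<in>set \<beta>. 0 < b" and "(r, 0) \<in> skew_diagram \<alpha> \<beta>" and "r < s"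
    and "(s, d) \<in> diagram \<alpha>"
  shows "(s, 0) \<in> skew_diagram \<alpha> \<beta>"
proof -
  \<comment> \<open>Parts of \<beta> are positive, so each row of \<beta> occupies its first cell. A
    first-column cell of the skew diagram therefore lies above all rows of \<beta>, and so does
    every higher row.\<close>
  have "length \<beta> \<le> r"
    using assms(2) bspec[OF assms(1), OF nth_mem, of r]
    by (cases "r < length \<beta>") (auto simp: skew_diagram_def diagram_def)
  then show ?thesis
    using assms(3,4) by (simp add: skew_diagram_def diagram_def)
qed

text \<open>The only delicate case is an entry of the first column directly preceded by an entry outside
  it: the latter would lie in a higher row, whose own first-column cell is already larger.\<close>

lemma minimal_consecutive:
  assumes T: "T \<in> SIT \<alpha> \<beta>" and \<beta>: "\<forall>b\<in>set \<beta>. 0 < b"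
    and min: "\<And>S. (S, T) \<notin> SIT_cover \<alpha> \<beta>"
    and x: "x \<in> skew_diagram \<alpha> \<beta>" and y: "y \<in> skew_diagram \<alpha> \<beta>" and Ty: "T y = Suc (T x)"
  shows "reading_less x y"
proof -
  let ?D = "skew_diagram \<alpha> \<beta>"
  obtain r c s d where xy: "x = (r, c)" "y = (s, d)" by (cases x; cases y) auto
  have col: "T (a, 0) < T (b, 0)" if "(a, 0) \<in> ?D" "(b, 0) \<in> ?D" "a < b" for a b
    using T that unfolding SIT_def by blast
  have row: "T (a, k) < T (a, l)" if "(a, k) \<in> ?D" "(a, l) \<in> ?D" "k < l" for a k l
    using T that unfolding SIT_def by blast
  have "snd x = 0 \<and> snd y = 0" if "fst x < fst y"
    using lower_cover[OF T x y Ty that] min by blast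
  then have up: "c = 0 \<and> d = 0" if "r < s"
    using that xy by simp
  have same: "c < d" if "r = s"
    using row[of s d c] x y xy Ty that by (cases c d rule: linorder_cases) auto
  have first: "c = 0" if "d = 0"
  proof (rule ccontr)
    assume "c \<noteq> 0"
    then have "s < r" using up same that by (cases r s rule: linorder_cases) auto
    then have "(r, 0) \<in> ?D"
      using column0_skew_diagram[OF \<beta>, of s \<alpha> r c] x y xy that by (simp add: skew_diagram_def)
    then have "T (s, 0) < T (r, 0)" "T (r, 0) < T (r, c)"
      using col[of s r] row[of r 0 c] x y xy that \<open>s < r\<close> \<open>c \<noteq> 0\<close> by auto
    then show False using Ty xy that by simp
  qed
  have "r < s" if "c = 0" "d = 0"
    using col[of s r] same x y xy Ty that by (cases r s rule: linorder_cases) auto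
  then show ?thesis
    using up same first by (cases r s rule: linorder_cases) (auto simp: xy)
qed

text \<open>Every value between \<open>T x\<close> and \<open>T y\<close> occurs as an entry, so the
  relation for consecutive entries chains up by transitivity.\<close>

lemma less_imp_reading_less:
  assumes T: "T \<in> SIT \<alpha> \<beta>"
    and step: "\<And>x y. x \<in> skew_diagram \<alpha> \<beta> \<Longrightarrow> y \<in> skew_diagram \<alpha> \<beta> \<Longrightarrow> T y = Suc (T x) \<Longrightarrow>
      reading_less x y"
    and x: "x \<in> skew_diagram \<alpha> \<beta>" and y: "y \<in> skew_diagram \<alpha> \<beta>" and less: "T x < T y"
  shows "reading_less x y"
  using y less
proof (induction "T y" arbitrary: y rule: less_induct)
  case less
  show ?case
  proof (cases "T y = Suc (T x)")
    case True
    then show ?thesis using step x less.prems by blast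
  next
    case False
    have "T y \<in> {1..sum_list \<alpha> - sum_list \<beta>}"
      using T less.prems(1) by (auto simp: SIT_def bij_betw_def)
    \<comment> \<open>In this case \<open>T y - 1\<close> still exceeds \<open>T x\<close>, so it is
      positive.\<close>
    then have "T y - 1 \<in> {1..sum_list \<alpha> - sum_list \<beta>}"
      using less.prems False by auto
    then obtain z where z: "z \<in> skew_diagram \<alpha> \<beta>" "T z = T y - 1"
      using entry_exists[OF T] by metis
    then have "reading_less x z"
      using less.hyps[of z] less.prems False by auto
    moreover have "reading_less z y"
      using step[OF z(1) less.prems(1)] z(2) less.prems by auto
    ultimately show ?thesis by (rule reading_less_trans)
  qed
qed

text \<open>A value is its rank, so a bijection onto an initial segment is determined by the order
  it induces on its domain. Fillings with the same comparisons are thus equal.\<close>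

lemma bij_betw_eq_Suc_card:
  fixes f :: "'a \<Rightarrow> nat"
  assumes "bij_betw f D {1..N}" and "x \<in> D"
  shows "f x = Suc (card {y \<in> D. f y < f x})"
proof -
  have im: "f ` D = {1..N}" and inj: "inj_on f D"
    using assms(1) by (auto simp: bij_betw_def)
  have fx: "f x \<in> {1..N}" using im assms(2) by blast
  have "f ` {y \<in> D. f y < f x} = {k \<in> f ` D. k < f x}" by auto
  also have "\<dots> = {1..<f x}" using fx by (auto simp: im)
  finally have "card {y \<in> D. f y < f x} = f x - 1"
    using card_image[of f "{y \<in> D. f y < f x}"] inj by (simp add: inj_on_def)
  then show ?thesis using fx by simp
qed

lemma minimal_eq_S0:
  assumes T: "T \<in> SIT \<alpha> \<beta>" and "\<forall>b\<in>set \<beta>. 0 < b" and "comp_le \<beta> \<alpha>"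
    and "\<And>S. (S, T) \<notin> SIT_cover \<alpha> \<beta>"
  shows "T = S0 \<alpha> \<beta>"
proof
  let ?D = "skew_diagram \<alpha> \<beta>"
  have bij: "bij_betw T ?D {1..sum_list \<alpha> - sum_list \<beta>}"
    using T by (simp add: SIT_def)
  have imp: "reading_less u v" if "u \<in> ?D" "v \<in> ?D" "T u < T v" for u v
    using less_imp_reading_less[OF T minimal_consecutive[OF T assms(2,4)]] that by blast
  \<comment> \<open>Distinct entries of \<open>T\<close> are comparable, so the one-way implication
    \<open>imp\<close> together with asymmetry of the reading order yields an equivalence.\<close>
  have iff: "T u < T v \<longleftrightarrow> S0 \<alpha> \<beta> u < S0 \<alpha> \<beta> v" if "u \<in> ?D" "v \<in> ?D" for u v
  proof (cases "T u = T v")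
    case True
    then have "u = v" using bij that by (auto simp: bij_betw_def dest: inj_onD)
    then show ?thesis by simp
  next
    case False
    then show ?thesis
      using imp[OF that] imp[OF that(2,1)] reading_less_asym S0_less_iff[OF that]
      by (cases "T u < T v") auto
  qed
  fix x
  show "T x = S0 \<alpha> \<beta> x"
  proof (cases "x \<in> ?D")
    case True
    then have "{y \<in> ?D. T y < T x} = {y \<in> ?D. S0 \<alpha> \<beta> y < S0 \<alpha> \<beta> x}"
      using iff by blast
    then show ?thesis
      using bij_betw_eq_Suc_card[OF bij True] bij_betw_eq_Suc_card[OF bij_betw_S0[OF assms(3)] True]
      by simp
  next
    case False
    then show ?thesis using SIT_outside[OF T] S0_outside by simp
  qed
qed

text \<open>Induction on the potential of \<open>SIT_cover_potential\<close>, which drops on passing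
  to a lower cover.\<close>

lemma S0_least:
  assumes "T \<in> SIT \<alpha> \<beta>" and "\<forall>b\<in>set \<beta>. 0 < b" and "comp_le \<beta> \<alpha>"
  shows "(S0 \<alpha> \<beta>, T) \<in> (SIT_cover \<alpha> \<beta>)\<^sup>*"
  using assms(1)
proof (induction "\<Sum>x\<in>skew_diagram \<alpha> \<beta>. T x * fst x" arbitrary: T rule: less_induct)
  case less
  show ?case
  proof (cases "\<exists>S. (S, T) \<in> SIT_cover \<alpha> \<beta>")
    case True
    then obtain S where S: "(S, T) \<in> SIT_cover \<alpha> \<beta>" ..
    then have "(S0 \<alpha> \<beta>, S) \<in> (SIT_cover \<alpha> \<beta>)\<^sup>*"
      using less.hyps SIT_cover_potential by (auto simp: SIT_cover_def)
    with S show ?thesis by simp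
  next
    case False
    then show ?thesis using minimal_eq_S0[OF less.prems assms(2,3)] by auto
  qed
qed

section \<open>Chains of generators\<close>

text \<open>The last letter acts first, so an appended letter is absorbed into the starting
  tableau.\<close>

lemma hecke_word_snoc: "hecke_pi i S = Some T \<Longrightarrow> hecke_word (w @ [i]) S = hecke_word w T"
  by (simp add: hecke_word_def)

lemma SIT_cover_chain:
  assumes "(S, T) \<in> (SIT_cover \<alpha> \<beta>)\<^sup>*"
  obtains r :: nat and j :: "nat \<Rightarrow> nat" and U :: "nat \<Rightarrow> tableau"
  where "U 0 = T" "U r = S" "inj_on U {0..r}"
    "\<And>i. i \<in> {1..r} \<Longrightarrow> U i \<in> SIT \<alpha> \<beta> \<and> j i \<in> {1..sum_list \<alpha> - sum_list \<beta> - 1} \<and>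
       hecke_pi (j i) (U i) = Some (U (i - 1))"
    "hecke_word (map j [1..<r + 1]) S = Some T"
proof -
  let ?f = "\<lambda>S. \<Sum>x\<in>skew_diagram \<alpha> \<beta>. S x * fst x :: nat"
  obtain r V where V: "V 0 = S" "V r = T" "\<And>i. i < r \<Longrightarrow> (V i, V (Suc i)) \<in> SIT_cover \<alpha> \<beta>"
    using assms by (auto simp: rtrancl_power relpow_fun_conv)
  \<comment> \<open>The path \<open>V\<close> climbs from \<open>S\<close> to \<open>T\<close>; the
    indexing of \<open>U\<close> is reversed so that it descends from \<open>T\<close>.\<close>
  define U where "U i = V (r - i)" for i
  have cover: "(U i, U (i - 1)) \<in> SIT_cover \<alpha> \<beta>" if "i \<in> {1..r}" for i
    using V(3)[of "r - i"] that by (simp add: U_def Suc_diff_le)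
  then have "\<forall>i\<in>{1..r}. \<exists>j. j \<in> {1..sum_list \<alpha> - sum_list \<beta> - 1} \<and>
      hecke_pi j (U i) = Some (U (i - 1))"
    unfolding SIT_cover_def by blast
  then obtain j where j: "\<And>i. i \<in> {1..r} \<Longrightarrow> j i \<in> {1..sum_list \<alpha> - sum_list \<beta> - 1} \<and>
      hecke_pi (j i) (U i) = Some (U (i - 1))"
    by metis
  \<comment> \<open>Strict decrease of the potential along the chain is what makes its tableaux
    distinct.\<close>
  have decr: "?f (U b) < ?f (U a)" if "a < b" "b \<le> r" for a b
    using that
  proof (induction b rule: less_Suc_induct)
    case (1 i)
    then show ?case using SIT_cover_potential[OF cover[of "Suc i"]] by simp
  next
    case (2 i k l)
    then show ?case by force
  qed
  have "inj_on U {0..r}"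
  proof (rule inj_onI)
    fix a b assume "a \<in> {0..r}" "b \<in> {0..r}" "U a = U b"
    then show "a = b"
      using decr[of a b] decr[of b a] by (cases a b rule: linorder_cases) auto
  qed
  \<comment> \<open>Induction on the length of the prefix: the first \<open>i\<close> letters carry
    \<open>U i\<close> back to \<open>U 0\<close>, and the letter \<open>j (Suc i)\<close> first
    carries \<open>U (Suc i)\<close> to \<open>U i\<close>.\<close>
  moreover have "hecke_word (map j [1..<i + 1]) (U i) = Some (U 0)" if "i \<le> r" for i
    using that
  proof (induction i)
    case 0
    then show ?case by (simp add: hecke_word_def)
  next
    case (Suc i)
    then show ?case using hecke_word_snoc[of "j (Suc i)" "U (Suc i)" "U i"] j[of "Suc i"] by simp
  qed
  from this[of r] have "hecke_word (map j [1..<r + 1]) S = Some T"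
    using V(1,2) by (simp add: U_def)
  moreover have "U i \<in> SIT \<alpha> \<beta>" if "i \<in> {1..r}" for i
    using cover[OF that] by (simp add: SIT_cover_def)
  ultimately show thesis
    using that[of U r j] j V(1,2) by (simp add: U_def)
qed

theorem proposition6p6:
  fixes \<alpha> \<beta> :: "nat list" and n m :: nat
  assumes "is_composition n \<alpha>" and "is_composition m \<beta>" and "comp_le \<beta> \<alpha>"
  shows "(\<forall>T\<in>SIT \<alpha> \<beta>. T \<noteq> S0 \<alpha> \<beta> \<longrightarrow>
            (\<exists>(r::nat) (j :: nat \<Rightarrow> nat) (U :: nat \<Rightarrow> tableau).
               U 0 = T \<and> U r = S0 \<alpha> \<beta> \<and>
               (\<forall>i\<in>{1..r}. U i \<in> SIT \<alpha> \<beta>) \<and> inj_on U {0..r} \<and>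
               (\<forall>i\<in>{1..r}. j i \<in> {1..n - m - 1} \<and> hecke_pi (j i) (U i) = Some (U (i - 1))) \<and>
               hecke_word (map j [1..<r + 1]) (S0 \<alpha> \<beta>) = Some T) \<and>
            (S0 \<alpha> \<beta>, T) \<in> SIT_poset \<alpha> \<beta>) \<and>
         {M \<in> SIT \<alpha> \<beta>. \<forall>S\<in>SIT \<alpha> \<beta>. (S, M) \<in> SIT_poset \<alpha> \<beta> \<longrightarrow> S = M} = {S0 \<alpha> \<beta>}"
proof -
  have \<beta>: "\<forall>b\<in>set \<beta>. 0 < b" and nm: "sum_list \<alpha> - sum_list \<beta> = n - m"
    using assms by (auto simp: is_composition_def)
  have least: "(S0 \<alpha> \<beta>, T) \<in> (SIT_cover \<alpha> \<beta>)\<^sup>*" if "T \<in> SIT \<alpha> \<beta>" for T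
    using S0_least[OF that \<beta> assms(3)] .
  have S0: "S0 \<alpha> \<beta> \<in> SIT \<alpha> \<beta>"
    using S0_in_SIT[OF assms(3)] .
  have le: "(S0 \<alpha> \<beta>, T) \<in> SIT_poset \<alpha> \<beta>" if "T \<in> SIT \<alpha> \<beta>" for T
    using least[OF that] S0 that by (simp add: SIT_poset_def)
  have "antisym (SIT_poset \<alpha> \<beta>)"
    using partial_order_SIT_poset by (auto simp: partial_order_on_def)
  \<comment> \<open>\<open>S0\<close> lies below every tableau, so antisymmetry leaves nothing
    strictly below it.\<close>
  then have "S = S0 \<alpha> \<beta>" if "S \<in> SIT \<alpha> \<beta>" "(S, S0 \<alpha> \<beta>) \<in> SIT_poset \<alpha> \<beta>" for S
    using le[OF that(1)] that(2) by (auto dest: antisymD)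
  \<comment> \<open>Conversely, any minimal tableau has \<open>S0\<close> below it and so equals
    \<open>S0\<close>.\<close>
  then have minimal: "{M \<in> SIT \<alpha> \<beta>. \<forall>S\<in>SIT \<alpha> \<beta>. (S, M) \<in> SIT_poset \<alpha> \<beta> \<longrightarrow> S = M} = {S0 \<alpha> \<beta>}"
    using le S0 by blast
  show ?thesis
  proof (intro conjI ballI impI minimal)
    fix T assume T: "T \<in> SIT \<alpha> \<beta>"
    then show "(S0 \<alpha> \<beta>, T) \<in> SIT_poset \<alpha> \<beta>" by (rule le)
    obtain r j U where "U 0 = T" "U r = S0 \<alpha> \<beta>" "inj_on U {0..r}"
      "\<And>i. i \<in> {1..r} \<Longrightarrow> U i \<in> SIT \<alpha> \<beta> \<and> j i \<in> {1..n - m - 1} \<and>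
         hecke_pi (j i) (U i) = Some (U (i - 1))"
      "hecke_word (map j [1..<r + 1]) (S0 \<alpha> \<beta>) = Some T"
      using SIT_cover_chain[OF least[OF T]] unfolding nm by metis
    then show "\<exists>r j U. U 0 = T \<and> U r = S0 \<alpha> \<beta> \<and>
        (\<forall>i\<in>{1..r}. U i \<in> SIT \<alpha> \<beta>) \<and> inj_on U {0..r} \<and>
        (\<forall>i\<in>{1..r}. j i \<in> {1..n - m - 1} \<and> hecke_pi (j i) (U i) = Some (U (i - 1))) \<and>
        hecke_word (map j [1..<r + 1]) (S0 \<alpha> \<beta>) = Some T"
      by blast
  qed
qed

end
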